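(* Let $T$ be a tree and $k$ a positive integer. The algorithm PVCPTree$(T,k)$ described below returns an optimal (i.e. minimum-cardinality) $k$-path vertex cover of $T$, and this cover has size at most $\frac{|V(T)|}{k}$. Consequently, $\psi_k(T)\le \frac{|V(T)|}{k}$.
   Context: Graphs are finite and simple. A path of order $k$ is a path on $k$ vertices. A subset $S\subseteq V(G)$ is a $k$-path vertex cover of a graph $G$ if every path of order $k$ in $G$ contains at least one vertex of $S$; $\psi_k(G)$ denotes the minimum cardinality of a $k$-path vertex cover of $G$. Let $T$ be rooted at a vertex $u$. For a vertex $v$, $T_v$ denotes the subtree induced by $v$ and all its descendants (with respect to the root $u$). $T_v$ is called a properly rooted subtree if (1) $T_v$ contains a path on $k$ vertices, and (2) $T_v$ with the vertex $v$ removed does not contain a path on $k$ vertices. Algorithm PVCPTree$(T,k)$: choose an arbitrary vertex $u$ of $T$ and root $T$ at $u$; set $S:=\emptyset$; while the current tree $T$ contains a properly rooted subtree $T_v$, set $S:=S\cup\{v\}$ and $T:=T\setminus T_v$ (delete all vertices of $T_v$); finally return $S$. *)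

theory Defs
  imports Complex_Main "Graph_Theory.Graph_Theory"
begin

text \<open>
  Finite simple graphs are the symmetric, loop-free, finite digraphs without parallel arcs of the
  library (locale \<^locale>\<open>graph\<close>). The library predicates \<^const>\<open>forest\<close> and \<^const>\<open>tree\<close> are
  not usable for them: they are based on directed cycles, so a pair of opposite arcs is already a
  cycle. Hence the explicit bound on the length below. The predicate \<^const>\<open>connected\<close> includes
  that there is at least one vertex.
\<close>

definition undirected_cycle :: "'a list \<Rightarrow> ('a, 'b) pre_digraph \<Rightarrow> bool" where
  "undirected_cycle c G \<longleftrightarrow> vpath c G \<and> 3 \<le> length c \<and> last c \<rightarrow>\<^bsub>G\<^esub> hd c"

definition undirected_tree :: "('a, 'b) pre_digraph \<Rightarrow> bool" where
  "undirected_tree T \<longleftrightarrow> graph T \<and> connected T \<and> \<not> (\<exists>c. undirected_cycle c T)"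

definition path_of_order :: "nat \<Rightarrow> 'a list \<Rightarrow> ('a, 'b) pre_digraph \<Rightarrow> bool" where
  "path_of_order k p G \<longleftrightarrow> vpath p G \<and> length p = k"

definition path_vertex_cover :: "nat \<Rightarrow> ('a, 'b) pre_digraph \<Rightarrow> 'a set \<Rightarrow> bool" where
  "path_vertex_cover k G S \<longleftrightarrow>
     S \<subseteq> verts G \<and> (\<forall>p. path_of_order k p G \<longrightarrow> set p \<inter> S \<noteq> {})"

definition psi :: "nat \<Rightarrow> ('a, 'b) pre_digraph \<Rightarrow> nat" where
  "psi k G = (LEAST n. \<exists>S. path_vertex_cover k G S \<and> card S = n)"

text \<open>
  In a tree rooted at \<open>u\<close>, the vertex \<open>v\<close> together with its descendants are the vertices \<open>w\<close> such
  that \<open>v\<close> lies on the (unique) path from \<open>u\<close> to \<open>w\<close>.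
\<close>

definition rooted_subtree :: "('a, 'b) pre_digraph \<Rightarrow> 'a \<Rightarrow> 'a \<Rightarrow> ('a, 'b) pre_digraph" where
  "rooted_subtree T u v =
     T \<restriction> {w. \<exists>p. vpath p T \<and> hd p = u \<and> last p = w \<and> v \<in> set p}"

definition properly_rooted :: "nat \<Rightarrow> ('a, 'b) pre_digraph \<Rightarrow> 'a \<Rightarrow> 'a \<Rightarrow> bool" where
  "properly_rooted k T u v \<longleftrightarrow>
     v \<in> verts T \<and>
     (\<exists>p. path_of_order k p (rooted_subtree T u v)) \<and>
     \<not> (\<exists>p. path_of_order k p (pre_digraph.del_vert (rooted_subtree T u v) v))"

text \<open>
  One iteration of the loop, as a relation on pairs of the current tree and the current set. The
  choice of the properly rooted subtree is nondeterministic; subtrees are taken in the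
  current tree.
\<close>

inductive pvcp_step ::
  "nat \<Rightarrow> 'a \<Rightarrow> ('a, 'b) pre_digraph \<times> 'a set \<Rightarrow> ('a, 'b) pre_digraph \<times> 'a set \<Rightarrow> bool"
  for k :: nat and u :: 'a where
  "properly_rooted k T u v \<Longrightarrow>
     pvcp_step k u (T, S) (T \<restriction> (verts T - verts (rooted_subtree T u v)), S \<union> {v})"

text \<open>\<open>S\<close> is a possible return value of the algorithm on \<open>T\<close> when the chosen root is \<open>u\<close>.\<close>

definition PVCPTree_returns :: "('a, 'b) pre_digraph \<Rightarrow> nat \<Rightarrow> 'a \<Rightarrow> 'a set \<Rightarrow> bool" where
  "PVCPTree_returns T k u S \<longleftrightarrow>
     (\<exists>T'. (pvcp_step k u)\<^sup>*\<^sup>* (T, {}) (T', S) \<and> \<not> (\<exists>v. properly_rooted k T' u v))"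

definition PVCPTree_terminates :: "('a, 'b) pre_digraph \<Rightarrow> nat \<Rightarrow> 'a \<Rightarrow> bool" where
  "PVCPTree_terminates T k u \<longleftrightarrow>
     \<not> (\<exists>f :: nat \<Rightarrow> ('a, 'b) pre_digraph \<times> 'a set.
          f 0 = (T, {}) \<and> (\<forall>i. pvcp_step k u (f i) (f (Suc i))))"

end

theory Submission
  imports Defs
begin

text \<open>
  The deleted subtrees are disjoint and each contains a path of order \<open>k\<close>. Hence every cover has
  an element in each of them, and each accounts for at least \<open>k\<close> vertices. Conversely, a path of
  order \<open>k\<close> that meets a deleted subtree but not its root lies inside that subtree, which is
  excluded by condition (2) of a properly rooted subtree. So the chosen roots cover all paths
  that are not in the remaining tree, and as long as that tree contains a path of order \<open>k\<close>, it has
  a properly rooted subtree.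
\<close>

section \<open>Walks and paths\<close>

lemma vwalk_append_iff:
  assumes "p \<noteq> []" "q \<noteq> []"
  shows "vwalk (p @ q) G \<longleftrightarrow> vwalk p G \<and> vwalk q G \<and> last p \<rightarrow>\<^bsub>G\<^esub> hd q"
  using assms by (auto simp: vwalk_def vwalk_arcs_append)

lemma vpath_append_iff:
  assumes "p \<noteq> []" "q \<noteq> []"
  shows "vpath (p @ q) G \<longleftrightarrow>
    vpath p G \<and> vpath q G \<and> last p \<rightarrow>\<^bsub>G\<^esub> hd q \<and> set p \<inter> set q = {}"
  using vwalk_append_iff[OF assms] by (auto simp: vpath_def)

lemma vpath_snoc_iff:
  assumes "p \<noteq> []"
  shows "vpath (p @ [x]) G \<longleftrightarrow> vpath p G \<and> x \<in> verts G \<and> last p \<rightarrow>\<^bsub>G\<^esub> x \<and> x \<notin> set p"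
  using vpath_append_iff[OF assms, of "[x]"] by (auto simp: vpath_def vwalk_def)

lemma set_vwalk_arcs_subset: "set (vwalk_arcs p) \<subseteq> set p \<times> set p"
  by (induction p rule: vwalk_arcs.induct) auto

lemma arcs_ends_induce_subgraph: "arcs_ends (G \<restriction> A) = arcs_ends G \<inter> A \<times> A"
  by (auto simp: arcs_ends_conv)

text \<open>Turns questions about paths in subtrees and remaining trees into questions about paths
  of one fixed graph with a bound on their vertices.\<close>

lemma vpath_induce_subgraph_iff:
  assumes "A \<subseteq> verts G"
  shows "vpath p (G \<restriction> A) \<longleftrightarrow> vpath p G \<and> set p \<subseteq> A"
  using assms set_vwalk_arcs_subset[of p]
  by (fastforce simp: vpath_def vwalk_def arcs_ends_induce_subgraph)

lemma del_vert_induce_subgraph: "pre_digraph.del_vert (G \<restriction> A) v = G \<restriction> (A - {v})"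
  by (auto simp: pre_digraph.del_vert_def induce_subgraph_def)

lemma (in sym_digraph) dominates_sym: "a \<rightarrow> b \<longleftrightarrow> b \<rightarrow> a"
  using sym_arcs by (blast intro: arcs_ends_symmetric)

lemma (in sym_digraph) vwalk_rev:
  assumes "vwalk p G"
  shows "vwalk (rev p) G"
proof -
  have "vwalk p G \<longrightarrow> vwalk (rev p) G"
    using assms
  proof (induction p rule: vwalk_induct)
    case (Cons u v es)
    show ?case
    proof
      assume "vwalk (u # v # es) G"
      then have "vwalk (rev (v # es)) G" "u \<in> verts G"
        using Cons by (auto elim: vwalk_consE)
      moreover have "last (rev (v # es)) \<rightarrow> u"
        using Cons(1) dominates_sym by (simp add: last_rev)
      ultimately show "vwalk (rev (u # v # es)) G"
        using vwalk_append_iff[of "rev (v # es)" "[u]" G] by (auto simp: vwalk_def)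
    qed
  qed simp
  then show ?thesis
    using assms by simp
qed

text \<open>Some consecutive pair on the walk straddles \<open>A\<close>; symmetry lets the arc be
  read from inside to outside, whichever of \<open>x\<close> and \<open>y\<close> comes
  first.\<close>

lemma (in sym_digraph) vwalk_crosses:
  assumes "vwalk p G" "x \<in> set p" "x \<in> A" "y \<in> set p" "y \<notin> A"
  obtains a b where "a \<in> set p" "a \<in> A" "b \<in> set p" "b \<notin> A" "a \<rightarrow> b"
proof -
  have "(\<exists>x\<in>set p. x \<in> A) \<longrightarrow> (\<exists>y\<in>set p. y \<notin> A) \<longrightarrow>
    (\<exists>a\<in>set p. \<exists>b\<in>set p. a \<in> A \<and> b \<notin> A \<and> a \<rightarrow> b)"
    using assms(1)
  proof (induction p rule: vwalk_induct)
    case (Cons u v es)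
    have "u \<rightarrow> v" "v \<rightarrow> u"
      using Cons(1) dominates_sym by auto
    then show ?case
      using Cons(2) by (auto 4 4)
  qed auto
  then show thesis
    using assms that by blast
qed

text \<open>Follow the first path to its first vertex \<open>z\<close> on the second one, then
  return along the second path to its second vertex \<open>b\<close>, which is adjacent to
  \<open>u\<close>.\<close>

lemma (in graph) undirected_cycle_if_diverging:
  assumes "vpath (u # a # p) G" "vpath (u # b # q) G" "a \<noteq> b"
    and last: "last (a # p) = last (b # q)"
  shows "\<exists>c. undirected_cycle c G"
proof -
  have "\<exists>z\<in>set (a # p). z \<in> set (b # q)"
    using last last_in_set[of "a # p"] last_in_set[of "b # q"] by auto
  then obtain p1 z p2 where p: "a # p = p1 @ z # p2" and z: "z \<in> set (b # q)"
    and disj: "\<forall>y\<in>set p1. y \<notin> set (b # q)"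
    using split_list_first_prop[of "a # p" "\<lambda>z. z \<in> set (b # q)"] by blast
  obtain q1 q2 where q: "b # q = q1 @ z # q2"
    using split_list[OF z] by blast
  let ?c = "(u # p1 @ [z]) @ rev q1"
  have up: "vpath ((u # p1 @ [z]) @ p2) G" and uq: "vpath ((u # q1 @ [z]) @ q2) G"
    using assms(1,2) p q by auto
  have P: "vwalk (u # p1 @ [z]) G" and Q: "vwalk (u # q1 @ [z]) G"
    using up uq by (auto simp: vpath_def intro: vwalkI_append_l)
  have Q': "vwalk (q1 @ [z]) G" "u \<rightarrow> b"
    using Q assms(2) by (auto simp: vpath_def elim!: vwalk_consE)
  have "vwalk ?c G"
  proof (cases "q1 = []")
    case False
    have "vwalk (rev (q1 @ [z])) G"
      using vwalk_rev Q' by blast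
    then have "vwalk (rev q1) G \<and> z \<rightarrow> hd (rev q1)"
      using vwalk_append_iff[of "[z]" "rev q1" G] False by simp
    then show ?thesis
      using vwalk_append_iff[of "u # p1 @ [z]" "rev q1" G] P False by simp
  qed (use P in simp)
  \<comment> \<open>\<open>p1\<close> avoids the second path because \<open>z\<close> is the first
    common vertex.\<close>
  moreover have "distinct ?c"
    using up uq disj q by (auto simp: vpath_def)
  moreover have "last ?c = b"
    using q by (cases q1) (auto simp: last_rev)
  \<comment> \<open>If \<open>p1\<close> and \<open>q1\<close> were both empty, then
    \<open>a = z = b\<close>.\<close>
  moreover have "3 \<le> length ?c"
    using p q \<open>a \<noteq> b\<close> by (cases p1; cases q1) auto
  ultimately have "undirected_cycle ?c G"
    using Q'(2) dominates_sym by (auto simp: undirected_cycle_def vpath_def)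
  then show ?thesis
    by blast
qed

text \<open>Strip the common first vertex: two paths with the same ends cannot differ in the next
  vertex without creating a cycle.\<close>

lemma (in graph) vpath_unique:
  assumes "\<nexists>c. undirected_cycle c G"
    and "vpath p G" "vpath q G" "hd p = hd q" "last p = last q"
  shows "p = q"
  using assms(2-)
proof (induction p arbitrary: q)
  case Nil
  then show ?case
    by (auto simp: vpath_def vwalk_def)
next
  case (Cons x p)
  then obtain q' where q: "q = x # q'"
    by (cases q) (auto simp: vpath_def vwalk_def)
  show ?case
  proof (cases "p = [] \<or> q' = []")
    \<comment> \<open>If one path is the single vertex \<open>x\<close>, the other also ends in
      \<open>x\<close>, and distinctness makes it trivial too.\<close>
    case True
    then show ?thesis
      using Cons.prems q last_in_set[of p] last_in_set[of q']
      by (auto simp: vpath_def split: if_splits)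
  next
    case False
    then obtain a p1 b q1 where p1: "p = a # p1" and q1: "q' = b # q1"
      by (auto simp: neq_Nil_conv)
    have "a = b"
      using undirected_cycle_if_diverging[of x a p1 b q1] assms(1) Cons.prems q p1 q1 by auto
    moreover have "vpath p G" "vpath q' G"
      using Cons.prems q False by (auto simp: vpath_def elim: vwalk_consE)
    ultimately show ?thesis
      using Cons.IH[of q'] Cons.prems q p1 q1 by simp
  qed
qed

section \<open>Root paths and descendants\<close>

text \<open>
  The root need not be a vertex, so that the empty graph, which remains after the subtree at the
  root has been deleted, is included.
\<close>

locale rooted_tree = graph +
  fixes u :: 'a
  assumes acyclic: "\<nexists>c. undirected_cycle c G"
    and reachable_root: "w \<in> verts G \<Longrightarrow> u \<rightarrow>\<^sup>* w"
begin

definition root_path :: "'a \<Rightarrow> 'a list" where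
  "root_path w = (THE p. vpath p G \<and> hd p = u \<and> last p = w)"

definition descendants :: "'a \<Rightarrow> 'a set" where
  "descendants v = {w \<in> verts G. v \<in> set (root_path w)}"

lemma root_path_eq:
  assumes "vpath p G" "hd p = u"
  shows "root_path (last p) = p"
  unfolding root_path_def using assms vpath_unique[OF acyclic] by (intro the_equality) auto

lemma root_path:
  assumes "w \<in> verts G"
  shows "vpath (root_path w) G" "hd (root_path w) = u" "last (root_path w) = w"
    "root_path w \<noteq> []" "w \<in> set (root_path w)"
proof -
  obtain p where p: "vpath p G" "hd p = u" "last p = w"
    using reachable_root[OF assms] reachable_vpath_conv by blast
  moreover have "root_path w = p"
    using p root_path_eq by blast
  moreover have "p \<noteq> []"
    using p by (auto simp: vpath_def vwalk_def)
  ultimately show "vpath (root_path w) G" "hd (root_path w) = u" "last (root_path w) = w"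
    "root_path w \<noteq> []" "w \<in> set (root_path w)"
    by (simp_all, metis last_in_set)
qed

lemma root_path_subset: "w \<in> verts G \<Longrightarrow> set (root_path w) \<subseteq> verts G"
  using root_path(1) by (auto simp: vpath_def vwalk_def)

text \<open>Cutting a root path at \<open>y\<close> leaves a path from \<open>u\<close> to
  \<open>y\<close>, which by uniqueness is the root path of \<open>y\<close>.\<close>

lemma root_path_prefix:
  assumes "x \<in> verts G" "y \<in> set (root_path x)"
  obtains ys where "root_path x = root_path y @ ys"
proof -
  obtain xs ys where xs: "root_path x = (xs @ [y]) @ ys"
    using split_list[OF assms(2)] by auto
  have "vpath ((xs @ [y]) @ ys) G" "hd (xs @ [y]) = u"
    using root_path(1,2)[OF assms(1)] xs by (auto simp: hd_append split: if_splits)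
  then have "vpath (xs @ [y]) G" "hd (xs @ [y]) = u"
    by (auto simp: vpath_def intro: vwalkI_append_l)
  then have "root_path y = xs @ [y]"
    using root_path_eq[of "xs @ [y]"] by simp
  then show thesis
    using xs that by simp
qed

text \<open>Every edge joins a parent and a child; this is where acyclicity enters the descendant
  structure.\<close>

lemma root_path_adj:
  assumes "x \<rightarrow> y"
  shows "root_path y = root_path x @ [y] \<or> root_path x = root_path y @ [x]"
proof (cases "y \<in> set (root_path x)")
  case False
  have x: "x \<in> verts G" "y \<in> verts G"
    using assms by (auto intro: adj_in_verts)
  have "vpath (root_path x @ [y]) G"
    using vpath_snoc_iff[of "root_path x" y G] False root_path[OF x(1)] x(2) assms by simp
  then show ?thesis
    using root_path_eq[of "root_path x @ [y]"] root_path[OF x(1)] by simp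
next
  case True
  have x: "x \<in> verts G" "y \<in> verts G" "x \<noteq> y"
    using assms adj_not_same by (auto intro: adj_in_verts)
  obtain ys where ys: "root_path x = root_path y @ ys"
    using root_path_prefix[OF x(1) True] .
  have "ys \<noteq> []"
    using ys root_path(3) x by (metis append_Nil2)
  then have last: "last ys = x"
    using ys root_path(3)[OF x(1)] by simp
  obtain xs where xs: "root_path y = xs @ [y]"
    using root_path(3,4)[OF x(2)] append_butlast_last_id by metis
  \<comment> \<open>The part of the root path from \<open>y\<close> to \<open>x\<close>, closed by
    the edge between them, would be a cycle unless it has just two vertices.\<close>
  have "vpath (xs @ (y # ys)) G"
    using ys xs root_path(1)[OF x(1)] by simp
  then have "vpath (y # ys) G"
    by (auto simp: vpath_def intro: vwalkI_append_r)
  moreover have "last (y # ys) \<rightarrow> hd (y # ys)"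
    using last \<open>ys \<noteq> []\<close> assms by simp
  ultimately have "\<not> 3 \<le> length (y # ys)"
    using acyclic unfolding undirected_cycle_def by blast
  then have "ys = [x]"
    using \<open>ys \<noteq> []\<close> last by (cases ys; cases "tl ys") auto
  then show ?thesis
    using ys by simp
qed

lemma descendants_subset: "descendants v \<subseteq> verts G"
  by (auto simp: descendants_def)

lemma descendants_self: "v \<in> verts G \<Longrightarrow> v \<in> descendants v"
  using root_path(5) by (simp add: descendants_def)

lemma descendants_mono:
  assumes "w \<in> descendants v"
  shows "descendants w \<subseteq> descendants v"
proof
  fix x assume x: "x \<in> descendants w"
  then obtain ys where "root_path x = root_path w @ ys"
    using root_path_prefix unfolding descendants_def by blast
  then show "x \<in> descendants v"
    using x assms by (auto simp: descendants_def)
qed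

lemma rooted_subtree_eq: "rooted_subtree G u v = G \<restriction> descendants v"
proof -
  have "(\<exists>p. vpath p G \<and> hd p = u \<and> last p = w \<and> v \<in> set p) \<longleftrightarrow> w \<in> descendants v" for w
  proof
    assume "\<exists>p. vpath p G \<and> hd p = u \<and> last p = w \<and> v \<in> set p"
    then obtain p where p: "vpath p G" "hd p = u" "last p = w" "v \<in> set p"
      by blast
    then have "w \<in> verts G"
      using last_in_set[of p] by (auto simp: vpath_def vwalk_def)
    then show "w \<in> descendants v"
      using p root_path_eq by (auto simp: descendants_def)
  next
    assume "w \<in> descendants v"
    then show "\<exists>p. vpath p G \<and> hd p = u \<and> last p = w \<and> v \<in> set p"
      using root_path by (auto simp: descendants_def)
  qed
  then show ?thesis
    by (simp add: rooted_subtree_def)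
qed

lemma properly_rooted_iff:
  "properly_rooted k G u v \<longleftrightarrow> v \<in> verts G \<and>
    (\<exists>p. path_of_order k p G \<and> set p \<subseteq> descendants v) \<and>
    (\<forall>p. path_of_order k p G \<longrightarrow> set p \<subseteq> descendants v \<longrightarrow> v \<in> set p)"
proof -
  have "descendants v - {v} \<subseteq> verts G"
    using descendants_subset by blast
  then show ?thesis
    unfolding properly_rooted_def rooted_subtree_eq del_vert_induce_subgraph path_of_order_def
      vpath_induce_subgraph_iff[OF descendants_subset]
    by (auto simp: vpath_induce_subgraph_iff)
qed

text \<open>The only edge out of a subtree leads from its root to the parent of that root.\<close>

lemma leave_descendants:
  assumes "x \<in> descendants v" "y \<notin> descendants v" "x \<rightarrow> y"
  shows "x = v" "root_path v = root_path y @ [v]"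
proof -
  have "y \<in> verts G"
    using assms(3) by (auto intro: adj_in_verts)
  \<comment> \<open>If \<open>y\<close> were the child of \<open>x\<close>, its root path would
    extend that of \<open>x\<close> and contain \<open>v\<close>. So \<open>y\<close> is the parent,
    and \<open>v\<close> can only be the last vertex \<open>x\<close>.\<close>
  then have "x = v \<and> root_path v = root_path y @ [v]"
    using root_path_adj[OF assms(3)] assms(1,2) by (auto simp: descendants_def)
  then show "x = v" "root_path v = root_path y @ [v]"
    by auto
qed

lemma vpath_in_descendants:
  assumes "vpath p G" "x \<in> set p" "x \<in> descendants v" "v \<notin> set p"
  shows "set p \<subseteq> descendants v"
proof
  fix y assume y: "y \<in> set p"
  show "y \<in> descendants v"
  proof (rule ccontr)
    assume "y \<notin> descendants v"
    then obtain a b where "a \<in> set p" "a \<in> descendants v" "b \<notin> descendants v" "a \<rightarrow> b"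
      using vwalk_crosses assms(1-3) y unfolding vpath_def by metis
    then show False
      using leave_descendants(1) assms(4) by blast
  qed
qed

text \<open>
  A vertex with a smallest subtree containing a path of order \<open>k\<close> is properly rooted: a path
  below \<open>v\<close> that avoids \<open>v\<close> cannot leave the subtree of a single child of \<open>v\<close>.
\<close>

lemma properly_rooted_exists:
  assumes "path_of_order k p G" "k > 0"
  shows "\<exists>v. properly_rooted k G u v"
proof -
  define Q where
    "Q v \<longleftrightarrow> v \<in> verts G \<and> (\<exists>p. path_of_order k p G \<and> set p \<subseteq> descendants v)" for v
  have "set p \<subseteq> verts G" "p \<noteq> []"
    using assms by (auto simp: path_of_order_def vpath_def vwalk_def)
  have all: "w \<in> descendants u" if "w \<in> verts G" for w
    using that root_path(2,4)[OF that] hd_in_set[of "root_path w"] by (auto simp: descendants_def)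
  \<comment> \<open>The locale leaves this open; here the root path of \<open>hd p\<close> starts in
    \<open>u\<close>.\<close>
  have "u \<in> verts G"
    using all[of "hd p"] \<open>set p \<subseteq> verts G\<close> \<open>p \<noteq> []\<close> root_path_subset hd_in_set
    unfolding descendants_def by blast
  then have "Q u"
    using all assms(1) \<open>set p \<subseteq> verts G\<close> unfolding Q_def by blast
  then obtain v where v: "Q v" and min: "\<And>w. Q w \<Longrightarrow> card (descendants v) \<le> card (descendants w)"
    using ex_has_least_nat[of Q u "\<lambda>v. card (descendants v)"] by blast
  have "v \<in> set q" if q: "path_of_order k q G" "set q \<subseteq> descendants v" for q
  proof (rule ccontr)
    assume nv: "v \<notin> set q"
    have vq: "vpath q G" "q \<noteq> []"
      using q(1) assms(2) by (auto simp: path_of_order_def)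
    let ?x = "hd q"
    have x: "?x \<in> set q" "?x \<in> descendants v" "?x \<in> verts G"
      using vq q(2) descendants_subset hd_in_set by blast+
    obtain ys where ys: "root_path ?x = root_path v @ ys"
      using root_path_prefix x unfolding descendants_def by blast
    have v_verts: "v \<in> verts G"
      using v by (simp add: Q_def)
    have "ys \<noteq> []"
      using ys root_path(3)[OF x(3)] root_path(3)[OF v_verts] x(1) nv by (metis append_Nil2)
    \<comment> \<open>\<open>c\<close> is the child of \<open>v\<close> on the way to
      \<open>hd q\<close>. It will contradict the minimality of \<open>v\<close>.\<close>
    then obtain c cs where c: "ys = c # cs"
      by (cases ys) auto
    have cx: "c \<in> set (root_path ?x)"
      using ys c by simp
    have c_verts: "c \<in> verts G"
      using cx root_path_subset[OF x(3)] by blast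
    have "vpath ((root_path v @ [c]) @ cs) G"
      using ys c root_path(1)[OF x(3)] by simp
    then have "vpath (root_path v @ [c]) G"
      by (auto simp: vpath_def intro: vwalkI_append_l)
    then have rc: "root_path c = root_path v @ [c]" and "c \<notin> set (root_path v)"
      using root_path_eq[of "root_path v @ [c]"] root_path[OF v_verts]
      by (auto simp: vpath_def)
    have "set q \<subseteq> descendants c"
    proof (rule ccontr)
      assume "\<not> set q \<subseteq> descendants c"
      then obtain y where "y \<in> set q" "y \<notin> descendants c"
        by blast
      moreover have "?x \<in> descendants c"
        using cx x by (simp add: descendants_def)
      ultimately obtain a b where ab: "a \<in> descendants c" "b \<in> set q" "b \<notin> descendants c" "a \<rightarrow> b"
        using vwalk_crosses vq(1) x(1) unfolding vpath_def by metis
      \<comment> \<open>An edge leaving the subtree of \<open>c\<close> must end in the parent of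
        \<open>c\<close>, which is \<open>v\<close>.\<close>
      then have "root_path b = root_path v"
        using leave_descendants(2)[of a c b] rc by simp
      moreover have "b \<in> verts G"
        using ab by (auto intro: adj_in_verts)
      ultimately have "b = v"
        using root_path(3) v_verts by metis
      then show False
        using nv ab by blast
    qed
    then have "Q c"
      using c_verts q unfolding Q_def by blast
    moreover have "descendants c \<subset> descendants v"
    proof
      show "descendants c \<subseteq> descendants v"
        using descendants_mono[of c v] rc c_verts root_path(5)[OF v_verts]
        by (auto simp: descendants_def)
      show "descendants c \<noteq> descendants v"
        using descendants_self[OF v_verts] \<open>c \<notin> set (root_path v)\<close> by (auto simp: descendants_def)
    qed
    then have "card (descendants c) < card (descendants v)"
      using finite_subset[OF descendants_subset] by (intro psubset_card_mono) auto
    ultimately show False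
      using min by fastforce
  qed
  then show ?thesis
    using v by (auto simp: properly_rooted_iff Q_def)
qed

text \<open>Deletion creates no cycle, and a surviving vertex keeps its whole root path.\<close>

lemma rooted_tree_delete_descendants: "rooted_tree (G \<restriction> (verts G - descendants v)) u"
proof -
  let ?H = "G \<restriction> (verts G - descendants v)"
  have ind: "induced_subgraph ?H G"
    by auto
  interpret H: digraph ?H
    using ind by (rule digraphI_induced)
  interpret H: sym_digraph ?H
    using ind by (rule induced_graph_imp_graph)
  have vp: "vpath p ?H \<longleftrightarrow> vpath p G \<and> set p \<subseteq> verts G - descendants v" for p
    by (rule vpath_induce_subgraph_iff) auto
  show ?thesis
  proof unfold_locales
    show "\<nexists>c. undirected_cycle c ?H"
      using acyclic unfolding undirected_cycle_def vp
      by (auto dest: dominates_induce_subgraphD)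
  next
    fix w assume w: "w \<in> verts ?H"
    then have wG: "w \<in> verts G" "v \<notin> set (root_path w)"
      by (auto simp: descendants_def)
    have "set (root_path w) \<inter> descendants v = {}"
    proof -
      \<comment> \<open>The root path of \<open>y\<close> is a prefix of that of \<open>w\<close>,
        which avoids \<open>v\<close>.\<close>
      have "v \<notin> set (root_path y)" if "y \<in> set (root_path w)" for y
        using root_path_prefix[OF wG(1) that] wG(2) by (metis UnCI set_append)
      then show ?thesis
        by (auto simp: descendants_def)
    qed
    then have "vpath (root_path w) ?H"
      using vp root_path(1) root_path_subset wG(1) by blast
    then show "u \<rightarrow>\<^sup>*\<^bsub>?H\<^esub> w"
      using H.reachable_vpath_conv root_path(2,3)[OF wG(1)] by blast
  qed
qed

end

lemma (in graph) rooted_treeI: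
  assumes "undirected_tree G" "u \<in> verts G"
  shows "rooted_tree G u"
proof unfold_locales
  show "\<nexists>c. undirected_cycle c G"
    using assms by (simp add: undirected_tree_def)
  show "u \<rightarrow>\<^sup>* w" if "w \<in> verts G" for w
    using assms that symmetric_connected_imp_strongly_connected[OF sym_arcs]
    by (auto simp: undirected_tree_def)
qed

section \<open>The algorithm\<close>

text \<open>The last three conjuncts give the covering property, the lower bound for any cover and
  the size bound. Both bounds count only vertices already deleted, so a step that deletes one more
  subtree can raise both sides.\<close>

definition pvcp_invariant ::
  "nat \<Rightarrow> ('a, 'b) pre_digraph \<Rightarrow> 'a \<Rightarrow> ('a, 'b) pre_digraph \<Rightarrow> 'a set \<Rightarrow> bool" where
  "pvcp_invariant k T u T' S \<longleftrightarrow>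
     rooted_tree T' u \<and> verts T' \<subseteq> verts T \<and>
     (\<forall>p. vpath p T' \<longleftrightarrow> vpath p T \<and> set p \<subseteq> verts T') \<and>
     S \<subseteq> verts T - verts T' \<and>
     (\<forall>p. path_of_order k p T \<longrightarrow> set p \<inter> S = {} \<longrightarrow> set p \<subseteq> verts T') \<and>
     (\<forall>C. path_vertex_cover k T C \<longrightarrow> card S \<le> card (C - verts T')) \<and>
     k * card S \<le> card (verts T - verts T')"

lemma pvcp_invariant_step:
  assumes inv: "pvcp_invariant k T u T1 S1" and fin: "finite (verts T)"
    and step: "pvcp_step k u (T1, S1) (T2, S2)"
  shows "pvcp_invariant k T u T2 S2"
proof -
  interpret rooted_tree T1 u
    using inv by (simp add: pvcp_invariant_def)
  obtain v where rooted: "properly_rooted k T1 u v" and S2: "S2 = insert v S1"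
    and T2: "T2 = T1 \<restriction> (verts T1 - descendants v)"
    using step by cases (auto simp: rooted_subtree_eq)
  let ?D = "descendants v"
  have sub: "verts T1 \<subseteq> verts T" and S1: "S1 \<subseteq> verts T - verts T1"
    and vp: "\<And>p. vpath p T1 \<longleftrightarrow> vpath p T \<and> set p \<subseteq> verts T1"
    and cov: "\<And>p. path_of_order k p T \<Longrightarrow> set p \<inter> S1 = {} \<Longrightarrow> set p \<subseteq> verts T1"
    and opt: "\<And>C. path_vertex_cover k T C \<Longrightarrow> card S1 \<le> card (C - verts T1)"
    and size: "k * card S1 \<le> card (verts T - verts T1)"
    using inv unfolding pvcp_invariant_def by blast+
  have v: "v \<in> verts T1"
    and through: "\<And>p. path_of_order k p T1 \<Longrightarrow> set p \<subseteq> ?D \<Longrightarrow> v \<in> set p"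
    using rooted by (auto simp: properly_rooted_iff)
  obtain q where q: "path_of_order k q T1" "set q \<subseteq> ?D"
    using rooted by (auto simp: properly_rooted_iff)
  have qT: "path_of_order k q T"
    using q vp by (simp add: path_of_order_def)
  have verts_T2: "verts T2 = verts T1 - ?D"
    by (simp add: T2)
  have fin_D: "finite ?D"
    using finite_subset[OF descendants_subset] by simp
  have card_S2: "card S2 = Suc (card S1)"
    using S2 S1 v finite_subset[OF S1] fin by (subst S2, subst card_insert_disjoint) auto
  show ?thesis
    unfolding pvcp_invariant_def
  proof (intro conjI allI impI)
    show "rooted_tree T2 u"
      unfolding T2 by (rule rooted_tree_delete_descendants)
    show "verts T2 \<subseteq> verts T"
      using sub by (auto simp: verts_T2)
    show "vpath p T2 \<longleftrightarrow> vpath p T \<and> set p \<subseteq> verts T2" for p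
      using vpath_induce_subgraph_iff[of "verts T1 - ?D" T1 p] vp[of p] by (auto simp: T2)
    show "S2 \<subseteq> verts T - verts T2"
      using S1 S2 v sub descendants_self[OF v] by (auto simp: verts_T2)
    show "set p \<subseteq> verts T2" if p: "path_of_order k p T" "set p \<inter> S2 = {}" for p
    proof -
      have p1: "set p \<subseteq> verts T1" "v \<notin> set p"
        using p S2 cov by auto
      then have "path_of_order k p T1"
        using p vp by (simp add: path_of_order_def)
      \<comment> \<open>A path that meets \<open>?D\<close> and avoids \<open>v\<close> lies inside
        \<open>?D\<close>, so by proper rootedness it would contain \<open>v\<close>.\<close>
      then have "set p \<inter> ?D = {}"
        using vpath_in_descendants[of p _ v] through p1(2) by (auto simp: path_of_order_def)
      then show ?thesis
        using p1 by (auto simp: verts_T2)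
    qed
    show "card S2 \<le> card (C - verts T2)" if C: "path_vertex_cover k T C" for C
    proof -
      \<comment> \<open>The path \<open>q\<close> inside \<open>?D\<close> is also a path of
        \<open>T\<close>, so \<open>C\<close> meets it.\<close>
      obtain c where c: "c \<in> C" "c \<in> ?D"
        using C qT q(2) unfolding path_vertex_cover_def by blast
      have "finite C"
        using C fin finite_subset unfolding path_vertex_cover_def by blast
      \<comment> \<open>\<open>c\<close> lies in \<open>?D\<close> and hence in \<open>T1\<close>,
        so it was not counted before.\<close>
      have "card S2 \<le> card (insert c (C - verts T1))"
        using opt[OF C] c descendants_subset[of v] \<open>finite C\<close>
        by (subst card_insert_disjoint) (auto simp: card_S2)
      also have "\<dots> \<le> card (C - verts T2)"
        using c \<open>finite C\<close> by (intro card_mono) (auto simp: verts_T2)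
      finally show ?thesis .
    qed
    \<comment> \<open>The new subtree contributes at least the \<open>k\<close> distinct vertices of
      \<open>q\<close>.\<close>
    have "k = card (set q)"
      using q(1) by (auto simp: path_of_order_def vpath_def distinct_card)
    also have "\<dots> \<le> card ?D"
      using q(2) fin_D by (rule card_mono[rotated])
    finally have "k * card S2 \<le> card (verts T - verts T1) + card ?D"
      using size by (simp add: card_S2)
    also have "\<dots> = card ((verts T - verts T1) \<union> ?D)"
      using fin fin_D descendants_subset by (intro card_Un_disjoint[symmetric]) auto
    also have "(verts T - verts T1) \<union> ?D = verts T - verts T2"
      using descendants_subset sub by (auto simp: verts_T2)
    finally show "k * card S2 \<le> card (verts T - verts T2)" .
  qed
qed

lemma pvcp_invariant_reachable:
  assumes "(pvcp_step k u)\<^sup>*\<^sup>* (T, {}) (T', S)" "rooted_tree T u"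
  shows "pvcp_invariant k T u T' S"
  using assms(1)
proof (induction rule: rtranclp_induct2)
  case refl
  then show ?case
    \<comment> \<open>Initially \<open>S\<close> is empty and nothing has been deleted, so both
      bounds read 0 on the left.\<close>
    using assms(2) by (auto simp: pvcp_invariant_def path_of_order_def vpath_def vwalk_def)
next
  case (step T1 S1 T2 S2)
  interpret rooted_tree T u
    by fact
  show ?case
    using pvcp_invariant_step[OF step.IH finite_verts step.hyps(2)] .
qed

lemma PVCPTree_returns_optimal:
  assumes "rooted_tree T u" "k > 0" "PVCPTree_returns T k u S"
  shows "is_arg_min card (path_vertex_cover k T) S" "k * card S \<le> card (verts T)"
proof -
  obtain T' where T': "(pvcp_step k u)\<^sup>*\<^sup>* (T, {}) (T', S)" "\<nexists>v. properly_rooted k T' u v"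
    using assms(3) unfolding PVCPTree_returns_def by blast
  have inv: "pvcp_invariant k T u T' S"
    using pvcp_invariant_reachable[OF T'(1) assms(1)] .
  interpret rooted_tree T u
    by fact
  interpret T': rooted_tree T' u
    using inv by (simp add: pvcp_invariant_def)
  have "set p \<inter> S \<noteq> {}" if p: "path_of_order k p T" for p
  proof
    assume "set p \<inter> S = {}"
    \<comment> \<open>An uncovered path survives in the final tree, which would then have a properly
      rooted subtree.\<close>
    then have "path_of_order k p T'"
      using inv p by (auto simp: pvcp_invariant_def path_of_order_def)
    then show False
      using T'.properly_rooted_exists assms(2) T'(2) by blast
  qed
  then have "path_vertex_cover k T S"
    using inv by (auto simp: path_vertex_cover_def pvcp_invariant_def)
  moreover have "card S \<le> card C" if C: "path_vertex_cover k T C" for C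
  proof -
    have "finite C"
      using C finite_subset[OF _ finite_verts] unfolding path_vertex_cover_def by blast
    then have "card (C - verts T') \<le> card C"
      by (intro card_mono) auto
    then show ?thesis
      using inv C unfolding pvcp_invariant_def by fastforce
  qed
  ultimately show "is_arg_min card (path_vertex_cover k T) S"
    by (fastforce simp: is_arg_min_def)
  have "card (verts T - verts T') \<le> card (verts T)"
    by (intro card_mono) auto
  then show "k * card S \<le> card (verts T)"
    using inv unfolding pvcp_invariant_def by linarith
qed

section \<open>Termination and existence of a result\<close>

lemma pvcp_step_decreases:
  assumes "pvcp_step k u (T1, S1) (T2, S2)" "k > 0" "finite (verts T1)"
  shows "finite (verts T2)" "card (verts T2) < card (verts T1)"
proof -
  obtain v where rooted: "properly_rooted k T1 u v"
    and T2: "T2 = T1 \<restriction> (verts T1 - verts (rooted_subtree T1 u v))"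
    using assms(1) by cases auto
  obtain p where p: "path_of_order k p (rooted_subtree T1 u v)"
    using rooted by (auto simp: properly_rooted_def)
  then have "hd p \<in> verts (rooted_subtree T1 u v)"
    using hd_in_set[of p] unfolding path_of_order_def vpath_def vwalk_def by blast
  \<comment> \<open>Each vertex of the subtree is by definition the last vertex of a path in
    \<open>T1\<close>.\<close>
  moreover have "verts (rooted_subtree T1 u v) \<subseteq> verts T1"
    using last_in_set by (fastforce simp: rooted_subtree_def vpath_def vwalk_def)
  ultimately have "verts T2 \<subset> verts T1"
    by (auto simp: T2)
  then show "finite (verts T2)" "card (verts T2) < card (verts T1)"
    using assms(3) finite_subset[of "verts T2" "verts T1"] psubset_card_mono by auto
qed

lemma PVCPTree_terminates:
  assumes "finite (verts T)" "k > 0"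
  shows "PVCPTree_terminates T k u"
  unfolding PVCPTree_terminates_def
proof
  assume "\<exists>f. f 0 = (T, {}) \<and> (\<forall>i. pvcp_step k u (f i) (f (Suc i)))"
  then obtain f where f: "f 0 = (T, {})" "\<And>i. pvcp_step k u (f i) (f (Suc i))"
    by blast
  have step: "finite (verts (fst (f i))) \<Longrightarrow> finite (verts (fst (f (Suc i)))) \<and>
    card (verts (fst (f (Suc i)))) < card (verts (fst (f i)))" for i
    using pvcp_step_decreases[of k u "fst (f i)" "snd (f i)" "fst (f (Suc i))" "snd (f (Suc i))"]
      f(2)[of i] assms(2) by auto
  \<comment> \<open>Finiteness is carried along the run, since only then does the vertex count
    strictly decrease.\<close>
  have "finite (verts (fst (f i)))" for i
    using step f(1) assms(1) by (induction i) auto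
  then have "\<forall>i. (f (Suc i), f i) \<in> measure (\<lambda>s. card (verts (fst s)))"
    using step by simp
  then show False
    using wf_iff_no_infinite_down_chain[of "measure (\<lambda>s. card (verts (fst s)))"] wf_measure
    by blast
qed

text \<open>Without it the optimality of all returned sets could hold vacuously and would give no
  bound on \<open>psi\<close>.\<close>

lemma PVCPTree_returns_exists:
  assumes "finite (verts T)" "k > 0"
  shows "\<exists>S. PVCPTree_returns T k u S"
proof -
  \<comment> \<open>The start set is generalised to \<open>S0\<close>, because the induction
    hypothesis is applied after a step that has enlarged it.\<close>
  have "\<exists>T' S'. (pvcp_step k u)\<^sup>*\<^sup>* (T0, S0) (T', S') \<and> (\<nexists>v. properly_rooted k T' u v)"
    if "finite (verts T0)" for T0 :: "('a, 'b) pre_digraph" and S0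
    using that
  proof (induction "card (verts T0)" arbitrary: T0 S0 rule: less_induct)
    case less
    show ?case
    proof (cases "\<exists>v. properly_rooted k T0 u v")
      case True
      then obtain T1 S1 where step: "pvcp_step k u (T0, S0) (T1, S1)"
        by (metis pvcp_step.intros)
      then obtain T' S' where
        "(pvcp_step k u)\<^sup>*\<^sup>* (T1, S1) (T', S')" "\<nexists>v. properly_rooted k T' u v"
        using less pvcp_step_decreases[OF step assms(2)] by blast
      then show ?thesis
        using step by (meson converse_rtranclp_into_rtranclp)
    qed blast
  qed
  then show ?thesis
    using assms(1) unfolding PVCPTree_returns_def by blast
qed

theorem theorem2:
  fixes T :: "('a, 'b) pre_digraph" and k :: nat
  assumes "undirected_tree T" and "k > 0"
  shows "(\<forall>u \<in> verts T.
            PVCPTree_terminates T k u \<and>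
            (\<forall>S. PVCPTree_returns T k u S \<longrightarrow>
               is_arg_min card (path_vertex_cover k T) S \<and>
               real (card S) \<le> real (card (verts T)) / real k)) \<and>
         real (psi k T) \<le> real (card (verts T)) / real k"
proof -
  interpret graph T
    using assms(1) by (simp add: undirected_tree_def)
  have main: "is_arg_min card (path_vertex_cover k T) S \<and>
      real (card S) \<le> real (card (verts T)) / real k"
    if u: "u \<in> verts T" and S: "PVCPTree_returns T k u S" for u S
  proof -
    have "k * card S \<le> card (verts T)"
      using PVCPTree_returns_optimal(2)[OF rooted_treeI[OF assms(1) u] assms(2) S] .
    then have "real k * real (card S) \<le> real (card (verts T))"
      by (metis of_nat_le_iff of_nat_mult)
    then show ?thesis
      using PVCPTree_returns_optimal(1)[OF rooted_treeI[OF assms(1) u] assms(2) S] assms(2)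
      by (simp add: field_simps)
  qed
  obtain u where u: "u \<in> verts T"
    using assms(1) by (auto simp: undirected_tree_def connected_def strongly_connected_def)
  \<comment> \<open>Any run from any root will do: its result is a cover that bounds
    \<open>psi\<close> from above.\<close>
  obtain S where "PVCPTree_returns T k u S"
    using PVCPTree_returns_exists[OF finite_verts assms(2)] by blast
  then have S: "path_vertex_cover k T S" "real (card S) \<le> real (card (verts T)) / real k"
    using main[OF u] by (auto simp: is_arg_min_def)
  have "psi k T \<le> card S"
    unfolding psi_def using S(1) by (intro Least_le) blast
  then have "real (psi k T) \<le> real (card (verts T)) / real k"
    using S(2) by linarith
  then show ?thesis
    using main PVCPTree_terminates[OF finite_verts assms(2)] by blast
qed

end
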